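(* Let $X$ be a path-connected topological space, $x_0\in X$, and let $H\leqslant\pi_1(X,x_0)$ be locally quasinormal. If $X$ has the discrete monodromy property relative to $H$, then every fiber of $p_H:\widetilde{X}_H\rightarrow X$ is T$_1$.
   Context: Let $X$ be path connected and $H\leqslant\pi_1(X,x_0)$. For $x\in X$ let $\mathcal{T}_x$ be the set of open neighborhoods of $x$ in $X$. For $U\in\mathcal{T}_x$ and a path $\alpha$ in $X$ from $x_0$ to $x$, put $\pi(\alpha,U)=\{[\alpha\cdot\delta\cdot\alpha^-]\mid\delta\text{ a loop in }U\text{ based at }x\}\leqslant\pi_1(X,x_0)$, where $\alpha^-$ is the reverse path. $H$ is called locally quasinormal if for every $x\in X$, every path $\alpha$ in $X$ from $x_0$ to $x$ and every $U\in\mathcal{T}_x$ there is a $V\in\mathcal{T}_x$ with $V\subseteq U$ and $H\pi(\alpha,V)=\pi(\alpha,V)H$. On paths $\alpha:([0,1],0)\rightarrow(X,x_0)$ let $\alpha\sim\beta$ iff $\alpha(1)=\beta(1)$ and $[\alpha\cdot\beta^-]\in H$; denote the class of $\alpha$ by $\langle\alpha\rangle$ and the set of classes by $\widetilde{X}_H$. Give $\widetilde{X}_H$ the topology generated by the basis elements $\langle\alpha,U\rangle=\{\langle\alpha\cdot\gamma\rangle\mid\gamma:([0,1],0)\rightarrow(U,\alpha(1))\}$, where $U\subseteq X$ is open and $\alpha(1)\in U$. Let $p_H:\widetilde{X}_H\rightarrow X$, $p_H(\langle\alpha\rangle)=\alpha(1)$. For a path $\beta$ in $X$ from $x$ to $y$,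 let $\Phi_\beta:p_H^{-1}(x)\rightarrow p_H^{-1}(y)$ be $\Phi_\beta(\langle\alpha\rangle)=\langle\alpha\cdot\beta\rangle$. $X$ has the discrete monodromy property relative to $H$ if for all $x,y\in X$ and every path $\beta$ from $x$ to $y$, $\Phi_\beta$ is either the identity function or its graph is a discrete subset of $p_H^{-1}(x)\times p_H^{-1}(y)\subseteq\widetilde{X}_H\times\widetilde{X}_H$. *)

theory Defs
  imports "HOL-Analysis.Analysis" "HOL-Algebra.Coset"
begin

text \<open>
  The space \<open>X\<close> is the universe of a type \<^typ>\<open>'a\<close> of class \<^class>\<open>topological_space\<close>.
  Paths are functions \<^typ>\<open>real \<Rightarrow> 'a\<close> whose values outside \<open>{0..1}\<close> are irrelevant:
  paths that agree on \<open>{0..1}\<close> are homotopic, hence lie in the same class below.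
\<close>

section \<open>The fundamental group\<close>

definition based_paths :: "'a::topological_space \<Rightarrow> (real \<Rightarrow> 'a) set" where
  "based_paths x0 = {p. path p \<and> pathstart p = x0}"

definition based_loops :: "'a::topological_space \<Rightarrow> (real \<Rightarrow> 'a) set" where
  "based_loops x0 = {p. path p \<and> pathstart p = x0 \<and> pathfinish p = x0}"

definition path_class :: "(real \<Rightarrow> 'a::topological_space) \<Rightarrow> (real \<Rightarrow> 'a) set" where
  "path_class p = {q. homotopic_paths UNIV p q}"

text \<open>
  The product is \<open>[p] \<cdot> [q] = [p \<cdot> q]\<close>; the union over representatives is a union of equal
  sets (lemma \<open>fundamental_group_mult\<close>).
\<close>

definition fundamental_group :: "'a::topological_space \<Rightarrow> (real \<Rightarrow> 'a) set monoid" where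
  "fundamental_group x0 =
     \<lparr>carrier = path_class ` based_loops x0,
      monoid.mult = (\<lambda>A B. \<Union>p\<in>A. \<Union>q\<in>B. path_class (p +++ q)),
      one = path_class (\<lambda>_. x0)\<rparr>"

definition loop_subgroup :: "(real \<Rightarrow> 'a::topological_space) \<Rightarrow> 'a set \<Rightarrow> (real \<Rightarrow> 'a) set set" where
  "loop_subgroup \<alpha> U =
     {path_class ((\<alpha> +++ \<delta>) +++ reversepath \<alpha>) |\<delta>.
        \<delta> \<in> based_loops (pathfinish \<alpha>) \<and> path_image \<delta> \<subseteq> U}"

definition locally_quasinormal :: "'a::topological_space \<Rightarrow> (real \<Rightarrow> 'a) set set \<Rightarrow> bool" where
  "locally_quasinormal x0 H \<longleftrightarrow>
     (\<forall>x. \<forall>\<alpha>\<in>based_paths x0. \<forall>U. pathfinish \<alpha> = x \<and> open U \<and> x \<in> U \<longrightarrow>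
        (\<exists>V. open V \<and> x \<in> V \<and> V \<subseteq> U \<and>
             H <#>\<^bsub>fundamental_group x0\<^esub> loop_subgroup \<alpha> V =
             loop_subgroup \<alpha> V <#>\<^bsub>fundamental_group x0\<^esub> H))"

section \<open>The space of path classes modulo \<open>H\<close>\<close>

definition path_rel ::
  "'a::topological_space \<Rightarrow> (real \<Rightarrow> 'a) set set \<Rightarrow> ((real \<Rightarrow> 'a) \<times> (real \<Rightarrow> 'a)) set" where
  "path_rel x0 H =
     {(\<alpha>, \<beta>). \<alpha> \<in> based_paths x0 \<and> \<beta> \<in> based_paths x0 \<and> pathfinish \<alpha> = pathfinish \<beta> \<and>
              path_class (\<alpha> +++ reversepath \<beta>) \<in> H}"

definition coset_class ::
  "'a::topological_space \<Rightarrow> (real \<Rightarrow> 'a) set set \<Rightarrow> (real \<Rightarrow> 'a) \<Rightarrow> (real \<Rightarrow> 'a) set" where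
  "coset_class x0 H \<alpha> = path_rel x0 H `` {\<alpha>}"

definition tilde_set :: "'a::topological_space \<Rightarrow> (real \<Rightarrow> 'a) set set \<Rightarrow> (real \<Rightarrow> 'a) set set" where
  "tilde_set x0 H = based_paths x0 // path_rel x0 H"

definition tilde_basic ::
  "'a::topological_space \<Rightarrow> (real \<Rightarrow> 'a) set set \<Rightarrow> (real \<Rightarrow> 'a) \<Rightarrow> 'a set \<Rightarrow> (real \<Rightarrow> 'a) set set" where
  "tilde_basic x0 H \<alpha> U =
     {coset_class x0 H (\<alpha> +++ \<gamma>) |\<gamma>.
        path \<gamma> \<and> pathstart \<gamma> = pathfinish \<alpha> \<and> path_image \<gamma> \<subseteq> U}"

definition tilde_topology ::
  "'a::topological_space \<Rightarrow> (real \<Rightarrow> 'a) set set \<Rightarrow> (real \<Rightarrow> 'a) set topology" where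
  "tilde_topology x0 H =
     topology_generated_by
       {tilde_basic x0 H \<alpha> U |\<alpha> U. \<alpha> \<in> based_paths x0 \<and> open U \<and> pathfinish \<alpha> \<in> U}"

text \<open>
  The endpoint projection does not mention \<open>H\<close>: all paths in a class share their endpoint
  (lemma \<open>endpoint_coset_class\<close>).
\<close>

definition endpoint :: "(real \<Rightarrow> 'a::topological_space) set \<Rightarrow> 'a" where
  "endpoint c = the_elem (pathfinish ` c)"

definition tilde_fiber ::
  "'a::topological_space \<Rightarrow> (real \<Rightarrow> 'a) set set \<Rightarrow> 'a \<Rightarrow> (real \<Rightarrow> 'a) set set" where
  "tilde_fiber x0 H x = {c \<in> tilde_set x0 H. endpoint c = x}"

section \<open>Monodromy\<close>

text \<open>Again a union of equal sets (lemma \<open>monodromy_coset_class\<close>).\<close>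

definition monodromy ::
  "'a::topological_space \<Rightarrow> (real \<Rightarrow> 'a) set set \<Rightarrow> (real \<Rightarrow> 'a) \<Rightarrow>
   (real \<Rightarrow> 'a) set \<Rightarrow> (real \<Rightarrow> 'a) set" where
  "monodromy x0 H \<beta> c = (\<Union>\<alpha>\<in>c. coset_class x0 H (\<alpha> +++ \<beta>))"

definition monodromy_graph ::
  "'a::topological_space \<Rightarrow> (real \<Rightarrow> 'a) set set \<Rightarrow> (real \<Rightarrow> 'a) \<Rightarrow>
   ((real \<Rightarrow> 'a) set \<times> (real \<Rightarrow> 'a) set) set" where
  "monodromy_graph x0 H \<beta> =
     {(c, monodromy x0 H \<beta> c) |c. c \<in> tilde_fiber x0 H (pathstart \<beta>)}"

text \<open>A subset is discrete when its subspace topology is the discrete one; it need not be closed.\<close>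

definition discrete_monodromy :: "'a::topological_space \<Rightarrow> (real \<Rightarrow> 'a) set set \<Rightarrow> bool" where
  "discrete_monodromy x0 H \<longleftrightarrow>
     (\<forall>x y \<beta>. path \<beta> \<and> pathstart \<beta> = x \<and> pathfinish \<beta> = y \<longrightarrow>
        (\<forall>c\<in>tilde_fiber x0 H x. monodromy x0 H \<beta> c = c) \<or>
        subtopology
          (prod_topology (subtopology (tilde_topology x0 H) (tilde_fiber x0 H x))
                         (subtopology (tilde_topology x0 H) (tilde_fiber x0 H y)))
          (monodromy_graph x0 H \<beta>)
        = discrete_topology (monodromy_graph x0 H \<beta>))"

section \<open>Well-definedness\<close>

lemma path_class_eq_iff:
  assumes "path p"
  shows "path_class p = path_class q \<longleftrightarrow> homotopic_paths UNIV p q"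
  using assms unfolding path_class_def
  by (metis (no_types, lifting) Collect_cong homotopic_paths_refl homotopic_paths_sym
      homotopic_paths_trans mem_Collect_eq subset_UNIV)

lemma hp_image:
  fixes p :: "real \<Rightarrow> 'a::topological_space"
  assumes "path p" "homotopic_paths {0..1} f g"
  shows "homotopic_paths UNIV (p \<circ> f) (p \<circ> g)"
  using homotopic_paths_continuous_image[OF assms(2)] assms(1) unfolding path_def by blast

lemma join_path_comp: "(p \<circ> f) +++ (p \<circ> g) = p \<circ> (f +++ g)"
  by (auto simp: joinpaths_def)

abbreviation (input) unit_path :: "real \<Rightarrow> real" where "unit_path \<equiv> linepath 0 1"

lemma comp_unit_path: "p \<circ> unit_path = p"
  by (auto simp: linepath_def)

lemma unit_path_image: "path_image unit_path = {0..1}"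
  by (simp add: closed_segment_eq_real_ivl)

lemma hp_rid:
  assumes "path p" "pathfinish p = x"
  shows "homotopic_paths UNIV (p +++ (\<lambda>_. x)) p"
proof -
  have "p \<circ> linepath 1 1 = (\<lambda>_. x)"
    using assms by (auto simp: linepath_def pathfinish_def)
  then show ?thesis
    using hp_image[OF assms(1) homotopic_paths_rid[of unit_path "{0..1}"]]
    by (simp flip: join_path_comp add: comp_unit_path closed_segment_eq_real_ivl)
qed

lemma hp_lid:
  assumes "path p" "pathstart p = x"
  shows "homotopic_paths UNIV ((\<lambda>_. x) +++ p) p"
proof -
  have "p \<circ> linepath 0 0 = (\<lambda>_. x)"
    using assms by (auto simp: linepath_def pathstart_def)
  then show ?thesis
    using hp_image[OF assms(1) homotopic_paths_lid[of unit_path "{0..1}"]]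
    by (simp flip: join_path_comp add: comp_unit_path closed_segment_eq_real_ivl)
qed

lemma hp_rinv:
  assumes "path p" "pathstart p = x"
  shows "homotopic_paths UNIV (p +++ reversepath p) (\<lambda>_. x)"
proof -
  have "p \<circ> linepath 0 0 = (\<lambda>_. x)" "p \<circ> reversepath unit_path = reversepath p"
    using assms by (auto simp: linepath_def pathstart_def reversepath_def)
  then show ?thesis
    using hp_image[OF assms(1) homotopic_paths_rinv[of unit_path "{0..1}"]]
    by (simp del: reversepath_linepath flip: join_path_comp
        add: comp_unit_path closed_segment_eq_real_ivl)
qed

lemma hp_linv:
  assumes "path p" "pathfinish p = x"
  shows "homotopic_paths UNIV (reversepath p +++ p) (\<lambda>_. x)"
  using hp_rinv[of "reversepath p" x] assms by simp

lemma hp_assoc: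
  fixes p q r :: "real \<Rightarrow> 'a::topological_space"
  assumes "path p" "path q" "path r" "pathfinish p = pathstart q" "pathfinish q = pathstart r"
  shows "homotopic_paths UNIV (p +++ (q +++ r)) ((p +++ q) +++ r)"
  by (rule homotopic_paths_assoc) (use assms in auto)


lemma path_class_self: "path p \<Longrightarrow> p \<in> path_class p"
  by (simp add: path_class_def)

lemma path_class_join_cong:
  fixes p q p' q' :: "real \<Rightarrow> 'a::topological_space"
  assumes "path p" "path q" "pathfinish p = pathstart q"
    and "p' \<in> path_class p" "q' \<in> path_class q"
  shows "path_class (p' +++ q') = path_class (p +++ q)"
proof -
  have "homotopic_paths UNIV (p +++ q) (p' +++ q')"
    using assms by (intro homotopic_paths_join) (auto simp: path_class_def)
  then show ?thesis
    using assms path_class_eq_iff[of "p +++ q" "p' +++ q'"] by simp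
qed

lemma fundamental_group_mult:
  assumes "p \<in> based_loops x0" "q \<in> based_loops x0"
  shows "path_class p \<otimes>\<^bsub>fundamental_group x0\<^esub> path_class q = path_class (p +++ q)"
proof -
  have pq: "path p" "path q" "pathfinish p = pathstart q"
    using assms by (auto simp: based_loops_def)
  have "(\<Union>p'\<in>path_class p. \<Union>q'\<in>path_class q. path_class (p' +++ q'))
        = (\<Union>p'\<in>path_class p. \<Union>q'\<in>path_class q. path_class (p +++ q))"
    using path_class_join_cong[OF pq] by (intro SUP_cong) auto
  also have "\<dots> = path_class (p +++ q)"
    using path_class_self[OF pq(1)] path_class_self[OF pq(2)] by (simp add: ex_in_conv[symmetric]) blast
  finally show ?thesis
    by (simp add: fundamental_group_def)
qed

lemma carrier_fundamental_group [simp]: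
  "carrier (fundamental_group x0) = path_class ` based_loops x0"
  by (simp add: fundamental_group_def)

lemma one_fundamental_group: "\<one>\<^bsub>fundamental_group x0\<^esub> = path_class (\<lambda>_. x0)"
  by (simp add: fundamental_group_def)

lemma based_loops_join [simp]:
  "p \<in> based_loops x0 \<Longrightarrow> q \<in> based_loops x0 \<Longrightarrow> p +++ q \<in> based_loops x0"
  by (simp add: based_loops_def)

lemma based_loops_reversepath [simp]:
  "p \<in> based_loops x0 \<Longrightarrow> reversepath p \<in> based_loops x0"
  by (simp add: based_loops_def)

lemma based_loops_const [simp]: "(\<lambda>_. x0) \<in> based_loops x0"
  by (simp add: based_loops_def path_def pathstart_def pathfinish_def)

lemma group_fundamental_group: "group (fundamental_group x0)"
proof (rule groupI)
  fix a b assume "a \<in> carrier (fundamental_group x0)" "b \<in> carrier (fundamental_group x0)"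
  then show "a \<otimes>\<^bsub>fundamental_group x0\<^esub> b \<in> carrier (fundamental_group x0)"
    by (auto simp: fundamental_group_mult)
next
  show "\<one>\<^bsub>fundamental_group x0\<^esub> \<in> carrier (fundamental_group x0)"
    by (simp add: one_fundamental_group)
next
  fix a b c
  assume "a \<in> carrier (fundamental_group x0)" "b \<in> carrier (fundamental_group x0)"
    "c \<in> carrier (fundamental_group x0)"
  then obtain p q r where pqr: "a = path_class p" "b = path_class q" "c = path_class r"
      "p \<in> based_loops x0" "q \<in> based_loops x0" "r \<in> based_loops x0"
    by auto
  then have "homotopic_paths UNIV (p +++ (q +++ r)) ((p +++ q) +++ r)"
    by (intro hp_assoc) (auto simp: based_loops_def)
  then have "path_class (p +++ (q +++ r)) = path_class ((p +++ q) +++ r)"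
    using path_class_eq_iff homotopic_paths_imp_path by blast
  then show "a \<otimes>\<^bsub>fundamental_group x0\<^esub> b \<otimes>\<^bsub>fundamental_group x0\<^esub> c
           = a \<otimes>\<^bsub>fundamental_group x0\<^esub> (b \<otimes>\<^bsub>fundamental_group x0\<^esub> c)"
    using pqr by (simp add: fundamental_group_mult)
next
  fix a assume "a \<in> carrier (fundamental_group x0)"
  then obtain p where p: "a = path_class p" "p \<in> based_loops x0"
    by auto
  then have "homotopic_paths UNIV ((\<lambda>_. x0) +++ p) p"
    by (intro hp_lid) (auto simp: based_loops_def)
  then have "path_class ((\<lambda>_. x0) +++ p) = path_class p"
    using path_class_eq_iff homotopic_paths_imp_path by blast
  then show "\<one>\<^bsub>fundamental_group x0\<^esub> \<otimes>\<^bsub>fundamental_group x0\<^esub> a = a"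
    using p by (simp add: fundamental_group_mult one_fundamental_group)
next
  fix a assume "a \<in> carrier (fundamental_group x0)"
  then obtain p where p: "a = path_class p" "p \<in> based_loops x0"
    by auto
  then have "homotopic_paths UNIV (reversepath p +++ p) (\<lambda>_. x0)"
    by (intro hp_linv) (auto simp: based_loops_def)
  then have "path_class (reversepath p +++ p) = path_class (\<lambda>_. x0)"
    using path_class_eq_iff homotopic_paths_imp_path by blast
  then show "\<exists>y\<in>carrier (fundamental_group x0).
               y \<otimes>\<^bsub>fundamental_group x0\<^esub> a = \<one>\<^bsub>fundamental_group x0\<^esub>"
    using p by (intro bexI[of _ "path_class (reversepath p)"])
      (simp_all add: fundamental_group_mult one_fundamental_group)
qed

lemma inv_fundamental_group:
  assumes "p \<in> based_loops x0"
  shows "inv\<^bsub>fundamental_group x0\<^esub> (path_class p) = path_class (reversepath p)"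
proof -
  interpret group "fundamental_group x0" by (rule group_fundamental_group)
  have "homotopic_paths UNIV (reversepath p +++ p) (\<lambda>_. x0)"
    using assms by (intro hp_linv) (auto simp: based_loops_def)
  then have "path_class (reversepath p +++ p) = path_class (\<lambda>_. x0)"
    using path_class_eq_iff homotopic_paths_imp_path by blast
  then have "path_class (reversepath p) \<otimes>\<^bsub>fundamental_group x0\<^esub> path_class p
             = \<one>\<^bsub>fundamental_group x0\<^esub>"
    using assms by (simp add: fundamental_group_mult one_fundamental_group)
  then show ?thesis
    using assms by (intro inv_equality) auto
qed

lemma hp_cancel:
  fixes p q r :: "real \<Rightarrow> 'a::topological_space"
  assumes "path p" "path q" "path r" "pathfinish p = pathfinish q" "pathstart r = pathfinish q"
  shows "homotopic_paths UNIV ((p +++ reversepath q) +++ (q +++ r)) (p +++ r)"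
proof -
  have q: "homotopic_paths UNIV (reversepath q +++ (q +++ r)) r"
  proof -
    have "homotopic_paths UNIV (reversepath q +++ (q +++ r)) ((reversepath q +++ q) +++ r)"
      using assms by (intro hp_assoc) auto
    also have "homotopic_paths UNIV \<dots> ((\<lambda>_. pathfinish q) +++ r)"
      using assms by (intro homotopic_paths_join hp_linv) auto
    also have "homotopic_paths UNIV \<dots> r"
      using assms by (intro hp_lid) auto
    finally show ?thesis .
  qed
  have "homotopic_paths UNIV ((p +++ reversepath q) +++ (q +++ r))
          (p +++ (reversepath q +++ (q +++ r)))"
    using assms by (intro homotopic_paths_sym[OF hp_assoc]) auto
  also have "homotopic_paths UNIV \<dots> (p +++ r)"
    using assms q by (intro homotopic_paths_join) auto
  finally show ?thesis .
qed

lemma equiv_path_rel: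
  fixes x0 :: "'a::topological_space"
  assumes "subgroup H (fundamental_group x0)"
  shows "equiv (based_paths x0) (path_rel x0 H)"
proof (rule equivI)
  interpret H: subgroup H "fundamental_group x0" by fact
  show "path_rel x0 H \<subseteq> based_paths x0 \<times> based_paths x0"
    by (auto simp: path_rel_def)
  show "refl_on (based_paths x0) (path_rel x0 H)"
  proof (rule refl_onI)
    fix p assume p: "p \<in> based_paths x0"
    then have "homotopic_paths UNIV (p +++ reversepath p) (\<lambda>_. x0)"
      by (intro hp_rinv) (auto simp: based_paths_def)
    then have "path_class (p +++ reversepath p) = path_class (\<lambda>_. x0)"
      using path_class_eq_iff homotopic_paths_imp_path by blast
    then show "(p, p) \<in> path_rel x0 H"
      using p H.one_closed by (auto simp: path_rel_def one_fundamental_group)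
  qed
  show "sym (path_rel x0 H)"
  proof (rule symI)
    fix p q assume pq: "(p, q) \<in> path_rel x0 H"
    then have l: "p +++ reversepath q \<in> based_loops x0"
      by (auto simp: path_rel_def based_loops_def based_paths_def)
    have "inv\<^bsub>fundamental_group x0\<^esub> (path_class (p +++ reversepath q)) \<in> H"
      using pq by (intro subgroup.m_inv_closed[OF assms]) (auto simp: path_rel_def)
    moreover have "reversepath (p +++ reversepath q) = q +++ reversepath p"
      using pq by (subst reversepath_joinpaths) (auto simp: path_rel_def)
    ultimately show "(q, p) \<in> path_rel x0 H"
      using pq l by (auto simp: path_rel_def inv_fundamental_group)
  qed
  show "trans (path_rel x0 H)"
  proof (rule transI)
    fix p q r assume pq: "(p, q) \<in> path_rel x0 H" and qr: "(q, r) \<in> path_rel x0 H"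
    then have l: "p +++ reversepath q \<in> based_loops x0" "q +++ reversepath r \<in> based_loops x0"
      by (auto simp: path_rel_def based_loops_def based_paths_def)
    have "homotopic_paths UNIV ((p +++ reversepath q) +++ (q +++ reversepath r))
            (p +++ reversepath r)"
      using pq qr by (intro hp_cancel) (auto simp: path_rel_def based_paths_def)
    then have "path_class ((p +++ reversepath q) +++ (q +++ reversepath r))
               = path_class (p +++ reversepath r)"
      using path_class_eq_iff homotopic_paths_imp_path by blast
    moreover have "path_class (p +++ reversepath q) \<otimes>\<^bsub>fundamental_group x0\<^esub>
                   path_class (q +++ reversepath r) \<in> H"
      using pq qr by (intro H.m_closed) (auto simp: path_rel_def)
    ultimately show "(p, r) \<in> path_rel x0 H"
      using pq qr l by (auto simp: path_rel_def fundamental_group_mult)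
  qed
qed

lemma endpoint_coset_class:
  assumes "subgroup H (fundamental_group x0)" "\<alpha> \<in> based_paths x0"
  shows "endpoint (coset_class x0 H \<alpha>) = pathfinish \<alpha>"
proof -
  have "\<alpha> \<in> coset_class x0 H \<alpha>"
    using equiv_class_self[OF equiv_path_rel[OF assms(1)] assms(2)] by (simp add: coset_class_def)
  moreover have "\<And>\<beta>. \<beta> \<in> coset_class x0 H \<alpha> \<Longrightarrow> pathfinish \<beta> = pathfinish \<alpha>"
    by (auto simp: coset_class_def path_rel_def)
  ultimately have "pathfinish ` coset_class x0 H \<alpha> = {pathfinish \<alpha>}"
    by blast
  then show ?thesis
    by (simp add: endpoint_def)
qed

lemma path_rel_join:
  fixes x0 :: "'a::topological_space"
  assumes "(\<alpha>, \<alpha>') \<in> path_rel x0 H" "path \<beta>" "pathstart \<beta> = pathfinish \<alpha>"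
  shows "(\<alpha> +++ \<beta>, \<alpha>' +++ \<beta>) \<in> path_rel x0 H"
proof -
  have a: "path \<alpha>" "path \<alpha>'" "pathfinish \<alpha> = pathfinish \<alpha>'" "pathstart \<alpha> = x0" "pathstart \<alpha>' = x0"
    using assms by (auto simp: path_rel_def based_paths_def)
  have "homotopic_paths UNIV ((\<alpha> +++ reversepath (reversepath \<beta>)) +++ (reversepath \<beta> +++ reversepath \<alpha>'))
          (\<alpha> +++ reversepath \<alpha>')"
    using assms a by (intro hp_cancel) auto
  then have "homotopic_paths UNIV ((\<alpha> +++ \<beta>) +++ reversepath (\<alpha>' +++ \<beta>)) (\<alpha> +++ reversepath \<alpha>')"
    using assms a by (simp add: reversepath_joinpaths)
  then have "path_class ((\<alpha> +++ \<beta>) +++ reversepath (\<alpha>' +++ \<beta>)) = path_class (\<alpha> +++ reversepath \<alpha>')"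
    using path_class_eq_iff homotopic_paths_imp_path by blast
  then show ?thesis
    using assms a by (auto simp: path_rel_def based_paths_def)
qed

lemma monodromy_coset_class:
  assumes H: "subgroup H (fundamental_group x0)" and \<alpha>: "\<alpha> \<in> based_paths x0"
    and \<beta>: "path \<beta>" "pathstart \<beta> = pathfinish \<alpha>"
  shows "monodromy x0 H \<beta> (coset_class x0 H \<alpha>) = coset_class x0 H (\<alpha> +++ \<beta>)"
proof -
  note eq = equiv_path_rel[OF H]
  have self: "\<alpha> \<in> coset_class x0 H \<alpha>"
    using equiv_class_self[OF eq \<alpha>] by (simp add: coset_class_def)
  have "coset_class x0 H (\<alpha>' +++ \<beta>) = coset_class x0 H (\<alpha> +++ \<beta>)"
    if "\<alpha>' \<in> coset_class x0 H \<alpha>" for \<alpha>'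
  proof -
    have "(\<alpha>, \<alpha>') \<in> path_rel x0 H"
      using that by (simp add: coset_class_def)
    then show ?thesis
      using path_rel_join \<beta> equiv_class_eq[OF eq] unfolding coset_class_def by metis
  qed
  then have "monodromy x0 H \<beta> (coset_class x0 H \<alpha>)
             = (\<Union>\<alpha>'\<in>coset_class x0 H \<alpha>. coset_class x0 H (\<alpha> +++ \<beta>))"
    unfolding monodromy_def by (intro SUP_cong) auto
  also have "\<dots> = coset_class x0 H (\<alpha> +++ \<beta>)"
    using self by (intro UN_constant_eq) auto
  finally show ?thesis .
qed

end

theory Submission
  imports Defs
begin

text \<open>
  Let \<open>a = \<langle>\<alpha>\<rangle>\<close> and \<open>b = \<langle>\<beta>\<rangle>\<close> be distinct points of a fiber such that every neighborhood of \<open>a\<close>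
  contains \<open>b\<close>. The loop \<open>\<gamma> = \<alpha>\<^sup>- \<cdot> \<beta>\<close> satisfies \<open>\<Phi>\<^sub>\<gamma> a = b \<noteq> a\<close>, so the graph of \<open>\<Phi>\<^sub>\<gamma>\<close> is discrete.
  For arbitrarily small \<open>V\<close> we may write \<open>b = \<langle>\<alpha> \<cdot> \<delta>\<rangle>\<close> with a loop \<open>\<delta>\<close> in \<open>V\<close>; that is,
  \<open>[\<beta> \<cdot> \<alpha>\<^sup>-] = h g\<close> with \<open>h \<in> H\<close> and \<open>g \<in> \<pi>(\<alpha>,V)\<close>. If \<open>H\<close> and \<open>\<pi>(\<alpha>,V)\<close> commute, then
  \<open>(h g)(h g) \<in> H h g \<pi>(\<alpha>,V)\<close>, which says \<open>\<Phi>\<^sub>\<gamma> b \<in> \<langle>\<beta>,V\<rangle>\<close>. Hence the points \<open>(b, \<Phi>\<^sub>\<gamma> b)\<close> of the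
  graph accumulate at \<open>(a, b)\<close>, a contradiction.
\<close>

section \<open>Homotopy identities and conjugated loop subgroups\<close>

lemma path_class_cong:
  assumes "homotopic_paths UNIV p q"
  shows "path_class p = path_class q"
  using assms path_class_eq_iff homotopic_paths_imp_path by blast

text \<open>Shows later that monodromy along \<open>reversepath \<alpha> +++ \<beta>\<close> carries
  the class of \<open>\<alpha>\<close> to that of \<open>\<beta>\<close>.\<close>

lemma homotopic_join_reversepath_join:
  fixes \<alpha> \<beta> :: "real \<Rightarrow> 'a::topological_space"
  assumes "path \<alpha>" "path \<beta>" "pathstart \<alpha> = pathstart \<beta>"
  shows "homotopic_paths UNIV (\<alpha> +++ (reversepath \<alpha> +++ \<beta>)) \<beta>"
proof -
  have "homotopic_paths UNIV (\<alpha> +++ (reversepath \<alpha> +++ \<beta>)) ((\<alpha> +++ reversepath \<alpha>) +++ \<beta>)"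
    using assms by (intro hp_assoc) auto
  also have "homotopic_paths UNIV \<dots> ((\<lambda>_. pathstart \<beta>) +++ \<beta>)"
    using assms by (intro homotopic_paths_join hp_rinv) auto
  also have "homotopic_paths UNIV \<dots> \<beta>"
    using assms by (intro hp_lid) auto
  finally show ?thesis .
qed

text \<open>Insert \<open>reversepath \<alpha> +++ \<alpha>\<close> between \<open>\<sigma>\<close>
  and \<open>\<rho>\<close>. Thus, after closing up along \<open>\<alpha>\<close>, appending a loop
  becomes right multiplication by its conjugate. For \<open>\<sigma> = \<alpha> +++ \<delta>\<close>
  this is multiplicativity of conjugation by \<open>\<alpha>\<close>.\<close>

lemma path_class_conj_hom:
  assumes "path \<alpha>" "path \<sigma>" "path \<rho>" "pathstart \<alpha> = x0" "pathstart \<sigma> = x0"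
    "pathfinish \<sigma> = pathfinish \<alpha>" "pathstart \<rho> = pathfinish \<alpha>" "pathfinish \<rho> = pathfinish \<alpha>"
  shows "path_class ((\<sigma> +++ \<rho>) +++ reversepath \<alpha>) =
    path_class (\<sigma> +++ reversepath \<alpha>) \<otimes>\<^bsub>fundamental_group x0\<^esub>
    path_class ((\<alpha> +++ \<rho>) +++ reversepath \<alpha>)"
proof -
  have "homotopic_paths UNIV ((\<sigma> +++ reversepath \<alpha>) +++ ((\<alpha> +++ \<rho>) +++ reversepath \<alpha>))
      ((\<sigma> +++ reversepath \<alpha>) +++ (\<alpha> +++ (\<rho> +++ reversepath \<alpha>)))"
    using assms by (intro homotopic_paths_join homotopic_paths_sym[OF hp_assoc]) auto
  also have "homotopic_paths UNIV \<dots> (\<sigma> +++ (\<rho> +++ reversepath \<alpha>))"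
    using assms by (intro hp_cancel) auto
  also have "homotopic_paths UNIV \<dots> ((\<sigma> +++ \<rho>) +++ reversepath \<alpha>)"
    using assms by (intro hp_assoc) auto
  finally have "path_class ((\<sigma> +++ reversepath \<alpha>) +++ ((\<alpha> +++ \<rho>) +++ reversepath \<alpha>))
      = path_class ((\<sigma> +++ \<rho>) +++ reversepath \<alpha>)"
    by (rule path_class_cong)
  then show ?thesis
    using assms by (subst fundamental_group_mult) (auto simp: based_loops_def)
qed

text \<open>Conjugation by \<open>\<alpha>\<close> respects products and inverses, and loops in
  \<open>U\<close> are closed under joining and reversal. The constant loop at the endpoint of
  \<open>\<alpha>\<close> gives the unit.\<close>

lemma subgroup_loop_subgroup:
  assumes "\<alpha> \<in> based_paths x0" "pathfinish \<alpha> \<in> U"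
  shows "subgroup (loop_subgroup \<alpha> U) (fundamental_group x0)"
proof
  have \<alpha>: "path \<alpha>" "pathstart \<alpha> = x0"
    using assms by (auto simp: based_paths_def)
  show "loop_subgroup \<alpha> U \<subseteq> carrier (fundamental_group x0)"
    using \<alpha> by (auto simp: loop_subgroup_def based_loops_def)
  show "u \<otimes>\<^bsub>fundamental_group x0\<^esub> v \<in> loop_subgroup \<alpha> U"
    if uv: "u \<in> loop_subgroup \<alpha> U" "v \<in> loop_subgroup \<alpha> U" for u v
  proof -
    obtain \<delta> \<epsilon> where *: "u = path_class ((\<alpha> +++ \<delta>) +++ reversepath \<alpha>)"
        "v = path_class ((\<alpha> +++ \<epsilon>) +++ reversepath \<alpha>)"
        "\<delta> \<in> based_loops (pathfinish \<alpha>)" "\<epsilon> \<in> based_loops (pathfinish \<alpha>)"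
        "path_image \<delta> \<subseteq> U" "path_image \<epsilon> \<subseteq> U"
      using uv by (auto simp: loop_subgroup_def)
    \<comment> \<open>Reassociated so that \<open>path_class_conj_hom\<close> applies with
      \<open>\<alpha> +++ \<delta>\<close> as \<open>\<sigma>\<close>.\<close>
    have "homotopic_paths UNIV ((\<alpha> +++ (\<delta> +++ \<epsilon>)) +++ reversepath \<alpha>)
        (((\<alpha> +++ \<delta>) +++ \<epsilon>) +++ reversepath \<alpha>)"
      using \<alpha> * by (intro homotopic_paths_join hp_assoc) (auto simp: based_loops_def)
    then have "path_class ((\<alpha> +++ (\<delta> +++ \<epsilon>)) +++ reversepath \<alpha>)
        = path_class (((\<alpha> +++ \<delta>) +++ \<epsilon>) +++ reversepath \<alpha>)"
      by (rule path_class_cong)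
    also have "\<dots> = u \<otimes>\<^bsub>fundamental_group x0\<^esub> v"
      unfolding * using \<alpha> * by (intro path_class_conj_hom) (auto simp: based_loops_def)
    finally have "u \<otimes>\<^bsub>fundamental_group x0\<^esub> v
        = path_class ((\<alpha> +++ (\<delta> +++ \<epsilon>)) +++ reversepath \<alpha>)" ..
    moreover have "\<delta> +++ \<epsilon> \<in> based_loops (pathfinish \<alpha>)" "path_image (\<delta> +++ \<epsilon>) \<subseteq> U"
      using * by (auto simp: based_loops_def path_image_join)
    ultimately show ?thesis
      by (auto simp: loop_subgroup_def)
  qed
  show "\<one>\<^bsub>fundamental_group x0\<^esub> \<in> loop_subgroup \<alpha> U"
  proof -
    let ?c = "\<lambda>_::real. pathfinish \<alpha>"
    have "?c \<in> based_loops (pathfinish \<alpha>)"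
      by simp
    then have "homotopic_paths UNIV ((\<alpha> +++ ?c) +++ reversepath \<alpha>) (\<alpha> +++ reversepath \<alpha>)"
      using \<alpha> by (intro homotopic_paths_join hp_rid) (auto simp: based_loops_def)
    also have "homotopic_paths UNIV \<dots> (\<lambda>_. x0)"
      using \<alpha> by (rule hp_rinv)
    finally have "path_class ((\<alpha> +++ ?c) +++ reversepath \<alpha>) = path_class (\<lambda>_. x0)"
      by (rule path_class_cong)
    moreover have "path_image ?c \<subseteq> U"
      using assms by (auto simp: path_image_def)
    ultimately show ?thesis
      using \<open>?c \<in> _\<close> unfolding loop_subgroup_def one_fundamental_group
      by (metis (mono_tags, lifting) mem_Collect_eq)
  qed
  show "inv\<^bsub>fundamental_group x0\<^esub> u \<in> loop_subgroup \<alpha> U" if "u \<in> loop_subgroup \<alpha> U" for u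
  proof -
    obtain \<delta> where *: "u = path_class ((\<alpha> +++ \<delta>) +++ reversepath \<alpha>)"
        "\<delta> \<in> based_loops (pathfinish \<alpha>)" "path_image \<delta> \<subseteq> U"
      using \<open>u \<in> _\<close> by (auto simp: loop_subgroup_def)
    have "inv\<^bsub>fundamental_group x0\<^esub> u = path_class (reversepath ((\<alpha> +++ \<delta>) +++ reversepath \<alpha>))"
      unfolding * using \<alpha> * by (intro inv_fundamental_group) (auto simp: based_loops_def)
    also have "\<dots> = path_class (\<alpha> +++ (reversepath \<delta> +++ reversepath \<alpha>))"
      using \<alpha> * by (simp add: reversepath_joinpaths based_loops_def)
    also have "\<dots> = path_class ((\<alpha> +++ reversepath \<delta>) +++ reversepath \<alpha>)"
      using \<alpha> * by (intro path_class_cong hp_assoc) (auto simp: based_loops_def)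
    finally show ?thesis
      using * by (auto simp: loop_subgroup_def intro!: exI[of _ "reversepath \<delta>"])
  qed
qed

section \<open>Points of a fiber as right cosets\<close>

lemma coset_class_eq_iff:
  assumes H: "subgroup H (fundamental_group x0)"
    and "\<sigma> \<in> based_paths x0" "\<tau> \<in> based_paths x0" "pathfinish \<sigma> = pathfinish \<tau>"
  shows "coset_class x0 H \<sigma> = coset_class x0 H \<tau> \<longleftrightarrow> path_class (\<sigma> +++ reversepath \<tau>) \<in> H"
proof -
  have "coset_class x0 H \<sigma> = coset_class x0 H \<tau> \<longleftrightarrow> (\<sigma>, \<tau>) \<in> path_rel x0 H"
    unfolding coset_class_def using eq_equiv_class_iff[OF equiv_path_rel[OF H]] assms by blast
  then show ?thesis
    using assms by (simp add: path_rel_def)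
qed

text \<open>
  Composing with the reverse of a fixed path \<open>\<alpha>\<close> identifies the points of its fiber with the right
  cosets of \<open>H\<close>.
\<close>

lemma coset_class_eq_iff_conj:
  assumes H: "subgroup H (fundamental_group x0)"
    and "\<alpha> \<in> based_paths x0" "\<sigma> \<in> based_paths x0" "\<tau> \<in> based_paths x0"
    and "pathfinish \<sigma> = pathfinish \<alpha>" "pathfinish \<tau> = pathfinish \<alpha>"
  shows "coset_class x0 H \<sigma> = coset_class x0 H \<tau> \<longleftrightarrow>
    path_class (\<sigma> +++ reversepath \<alpha>) \<otimes>\<^bsub>fundamental_group x0\<^esub>
    inv\<^bsub>fundamental_group x0\<^esub> path_class (\<tau> +++ reversepath \<alpha>) \<in> H"
proof -
  have "path_class (\<sigma> +++ reversepath \<alpha>) \<otimes>\<^bsub>fundamental_group x0\<^esub>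
      inv\<^bsub>fundamental_group x0\<^esub> path_class (\<tau> +++ reversepath \<alpha>)
    = path_class ((\<sigma> +++ reversepath \<alpha>) +++ (\<alpha> +++ reversepath \<tau>))"
    using assms by (subst inv_fundamental_group, force simp: based_loops_def based_paths_def)
      (subst fundamental_group_mult, auto simp: based_loops_def based_paths_def reversepath_joinpaths)
  also have "\<dots> = path_class (\<sigma> +++ reversepath \<tau>)"
    using assms by (intro path_class_cong hp_cancel) (auto simp: based_paths_def)
  finally show ?thesis
    using coset_class_eq_iff[OF H] assms by simp
qed

text \<open>Both sides are the value of \<open>monodromy x0 H \<beta>\<close> at one class; equal
  classes have equal endpoints, so \<open>\<beta>\<close> can follow \<open>\<alpha>'\<close>
  too.\<close>

lemma coset_class_join_cong:
  assumes H: "subgroup H (fundamental_group x0)"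
    and "\<alpha> \<in> based_paths x0" "\<alpha>' \<in> based_paths x0" "coset_class x0 H \<alpha> = coset_class x0 H \<alpha>'"
    and "path \<beta>" "pathstart \<beta> = pathfinish \<alpha>"
  shows "coset_class x0 H (\<alpha> +++ \<beta>) = coset_class x0 H (\<alpha>' +++ \<beta>)"
  using assms monodromy_coset_class[OF H] endpoint_coset_class[OF H] by metis

lemma coset_class_homotopic:
  assumes H: "subgroup H (fundamental_group x0)"
    and "homotopic_paths UNIV \<alpha> \<beta>" "pathstart \<alpha> = x0"
  shows "coset_class x0 H \<alpha> = coset_class x0 H \<beta>"
proof -
  have ab: "path \<alpha>" "path \<beta>" "pathstart \<beta> = x0" "pathfinish \<alpha> = pathfinish \<beta>"
    using homotopic_paths_imp_path[OF assms(2)] homotopic_paths_imp_pathstart[OF assms(2)]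
      homotopic_paths_imp_pathfinish[OF assms(2)] assms(3) by auto
  have "homotopic_paths UNIV (\<alpha> +++ reversepath \<beta>) (\<beta> +++ reversepath \<beta>)"
    using assms ab by (intro homotopic_paths_join) auto
  also have "homotopic_paths UNIV \<dots> (\<lambda>_. x0)"
    using ab by (intro hp_rinv)
  finally have "path_class (\<alpha> +++ reversepath \<beta>) \<in> H"
    using subgroup.one_closed[OF H] path_class_cong by (metis one_fundamental_group)
  then show ?thesis
    using coset_class_eq_iff[OF H] ab assms by (simp add: based_paths_def)
qed

section \<open>Neighborhood bases in the space of classes\<close>

lemma coset_class_in_tilde_basic:
  assumes H: "subgroup H (fundamental_group x0)"
    and "\<alpha> \<in> based_paths x0" "pathfinish \<alpha> \<in> U"
  shows "coset_class x0 H \<alpha> \<in> tilde_basic x0 H \<alpha> U"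
proof -
  let ?c = "\<lambda>_::real. pathfinish \<alpha>"
  have "coset_class x0 H (\<alpha> +++ ?c) = coset_class x0 H \<alpha>"
    using assms by (intro coset_class_homotopic hp_rid) (auto simp: based_paths_def)
  moreover have "path ?c" "pathstart ?c = pathfinish \<alpha>" "path_image ?c \<subseteq> U"
    using assms based_loops_const[of "pathfinish \<alpha>"] by (auto simp: based_loops_def path_image_def)
  ultimately show ?thesis
    unfolding tilde_basic_def by (metis (mono_tags, lifting) mem_Collect_eq)
qed

text \<open>If \<open>\<beta>\<close> is equivalent to \<open>\<alpha> +++ \<gamma>\<close>, then an
  extension \<open>\<beta> +++ \<rho>\<close> is equivalent to
  \<open>\<alpha> +++ (\<gamma> +++ \<rho>)\<close>, and \<open>\<gamma> +++ \<rho>\<close> stays in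
  \<open>U\<close>. Basic sets can therefore be recentered at any of their points.\<close>

lemma tilde_basic_subset:
  assumes H: "subgroup H (fundamental_group x0)"
    and \<alpha>: "\<alpha> \<in> based_paths x0" and \<beta>: "\<beta> \<in> based_paths x0"
    and mem: "coset_class x0 H \<beta> \<in> tilde_basic x0 H \<alpha> U"
  shows "pathfinish \<beta> \<in> U \<and> tilde_basic x0 H \<beta> U \<subseteq> tilde_basic x0 H \<alpha> U"
proof -
  obtain \<gamma> where \<gamma>: "coset_class x0 H \<beta> = coset_class x0 H (\<alpha> +++ \<gamma>)" "path \<gamma>"
      "pathstart \<gamma> = pathfinish \<alpha>" "path_image \<gamma> \<subseteq> U"
    using mem by (auto simp: tilde_basic_def)
  have \<alpha>\<gamma>: "\<alpha> +++ \<gamma> \<in> based_paths x0"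
    using \<alpha> \<gamma> by (auto simp: based_paths_def)
  have fin: "pathfinish \<beta> = pathfinish \<gamma>"
    using endpoint_coset_class[OF H \<beta>] endpoint_coset_class[OF H \<alpha>\<gamma>] \<gamma>(1) by simp
  have "coset_class x0 H (\<beta> +++ \<rho>) \<in> tilde_basic x0 H \<alpha> U"
    if \<rho>: "path \<rho>" "pathstart \<rho> = pathfinish \<beta>" "path_image \<rho> \<subseteq> U" for \<rho>
  proof -
    have "coset_class x0 H (\<beta> +++ \<rho>) = coset_class x0 H ((\<alpha> +++ \<gamma>) +++ \<rho>)"
      using coset_class_join_cong[OF H \<beta> \<alpha>\<gamma> \<gamma>(1)] \<rho> by simp
    also have "\<dots> = coset_class x0 H (\<alpha> +++ (\<gamma> +++ \<rho>))"
      using \<alpha> \<gamma> \<rho> fin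
      by (intro coset_class_homotopic[OF H] homotopic_paths_sym[OF hp_assoc])
        (auto simp: based_paths_def)
    finally show ?thesis
      using \<gamma> \<rho> fin unfolding tilde_basic_def
      by (auto intro!: exI[of _ "\<gamma> +++ \<rho>"] simp: path_image_join)
  qed
  then show ?thesis
    using fin \<gamma>(4) pathfinish_in_path_image[of \<gamma>] by (auto simp: tilde_basic_def)
qed

text \<open>Induction over the generation of \<open>S\<close>: formally the generators are only a
  subbasis, but the sets centered at the given representative \<open>\<alpha>\<close> form a
  neighborhood basis.\<close>

lemma openin_tilde_topology_nbhd:
  assumes H: "subgroup H (fundamental_group x0)"
    and "openin (tilde_topology x0 H) S" and \<alpha>: "\<alpha> \<in> based_paths x0" "coset_class x0 H \<alpha> \<in> S"
  shows "\<exists>U. open U \<and> pathfinish \<alpha> \<in> U \<and> tilde_basic x0 H \<alpha> U \<subseteq> S"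
proof -
  have "generate_topology_on
      {tilde_basic x0 H \<alpha> U |\<alpha> U. \<alpha> \<in> based_paths x0 \<and> open U \<and> pathfinish \<alpha> \<in> U} S"
    using assms(2) by (simp add: tilde_topology_def openin_topology_generated_by_iff)
  then show ?thesis
    using \<alpha>(2)
  proof induction
    case Empty
    then show ?case by simp
  next
    case (Int A B)
    then obtain U V where "open U" "pathfinish \<alpha> \<in> U" "tilde_basic x0 H \<alpha> U \<subseteq> A"
        "open V" "pathfinish \<alpha> \<in> V" "tilde_basic x0 H \<alpha> V \<subseteq> B"
      by auto
    moreover have "tilde_basic x0 H \<alpha> (U \<inter> V) \<subseteq> tilde_basic x0 H \<alpha> U \<inter> tilde_basic x0 H \<alpha> V"
      by (auto simp: tilde_basic_def)
    ultimately show ?case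
      by (intro exI[of _ "U \<inter> V"]) auto
  next
    case (UN K)
    then show ?case by (meson Sup_upper UnionE subset_trans)
  next
    \<comment> \<open>The generator may be centered at another path; it is recentered at
      \<open>\<alpha>\<close>.\<close>
    case (Basis S)
    then show ?case using tilde_basic_subset[OF H _ \<alpha>(1)] by blast
  qed
qed

section \<open>Permuting subgroups and the square of a monodromy step\<close>

text \<open>With \<open>b = h g\<close>, the commutation \<open>g h = h' g'\<close> gives \<open>b b = (h h' h\<^sup>-\<^sup>1) b (g\<^sup>-\<^sup>1 g' g)\<close>.\<close>

lemma (in group) square_in_coset_of_permuting_subgroups:
  assumes "subgroup H G" "subgroup K G" "H <#> K = K <#> H" "h \<in> H" "g \<in> K"
  shows "\<exists>k\<in>K. (h \<otimes> g) \<otimes> (h \<otimes> g) \<otimes> inv ((h \<otimes> g) \<otimes> k) \<in> H"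
proof -
  interpret H: subgroup H G by fact
  interpret K: subgroup K G by fact
  have "g \<otimes> h \<in> K <#> H"
    using assms(4,5) by (auto simp: set_mult_def)
  then have "g \<otimes> h \<in> H <#> K"
    by (simp only: assms(3))
  then obtain h' g' where hg: "h' \<in> H" "g' \<in> K" "g \<otimes> h = h' \<otimes> g'"
    by (auto simp: set_mult_def)
  have c: "h \<in> carrier G" "h' \<in> carrier G" "g \<in> carrier G" "g' \<in> carrier G"
    using assms hg by auto
  \<comment> \<open>In products associated to the right, an inverse pair is not a subterm by itself;
    these rules cancel it there.\<close>
  have cancel: "x \<otimes> (inv x \<otimes> y) = y" "inv x \<otimes> (x \<otimes> y) = y"
    if "x \<in> carrier G" "y \<in> carrier G" for x y
    using that by (simp_all add: m_assoc[symmetric])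
  have k: "(h \<otimes> g) \<otimes> (inv g \<otimes> g' \<otimes> g) = h \<otimes> g' \<otimes> g"
    using c by (simp add: m_assoc cancel)
  have "(h \<otimes> g) \<otimes> (h \<otimes> g) = h \<otimes> (g \<otimes> h) \<otimes> g"
    using c by (simp add: m_assoc)
  also have "\<dots> = (h \<otimes> h' \<otimes> inv h) \<otimes> (h \<otimes> g' \<otimes> g)"
    unfolding hg(3) using c by (simp add: m_assoc cancel)
  finally have "(h \<otimes> g) \<otimes> (h \<otimes> g) \<otimes> inv (h \<otimes> g' \<otimes> g) = h \<otimes> h' \<otimes> inv h"
    using c by (simp add: m_assoc inv_mult_group cancel)
  then show ?thesis
    using assms hg k by (intro bexI[of _ "inv g \<otimes> g' \<otimes> g"]) simp_all
qed

text \<open>Closing up along \<open>\<alpha>\<close> turns \<open>\<beta>\<close> into an element b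
  and \<open>\<beta> +++ (reversepath \<alpha> +++ \<beta>)\<close> into b b. The preceding lemma
  puts b b into the coset of b k with k in \<open>loop_subgroup \<alpha> V\<close>, and b k comes
  from extending \<open>\<beta>\<close> by a loop in \<open>V\<close>.\<close>

lemma monodromy_in_tilde_basic:
  assumes H: "subgroup H (fundamental_group x0)"
    and \<alpha>: "\<alpha> \<in> based_paths x0" and \<beta>: "\<beta> \<in> based_paths x0" "pathfinish \<beta> = pathfinish \<alpha>"
    and V: "pathfinish \<alpha> \<in> V"
      "H <#>\<^bsub>fundamental_group x0\<^esub> loop_subgroup \<alpha> V = loop_subgroup \<alpha> V <#>\<^bsub>fundamental_group x0\<^esub> H"
    and mem: "coset_class x0 H \<beta> \<in> tilde_basic x0 H \<alpha> V"
  shows "coset_class x0 H (\<beta> +++ (reversepath \<alpha> +++ \<beta>)) \<in> tilde_basic x0 H \<beta> V"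
proof -
  let ?G = "fundamental_group x0" and ?\<gamma> = "reversepath \<alpha> +++ \<beta>"
  let ?cl = "\<lambda>\<sigma>. path_class (\<sigma> +++ reversepath \<alpha>)"
  interpret G: group ?G by (rule group_fundamental_group)
  note p = \<alpha>[unfolded based_paths_def] \<beta>(1)[unfolded based_paths_def] \<beta>(2)
  obtain \<delta> where \<delta>: "coset_class x0 H \<beta> = coset_class x0 H (\<alpha> +++ \<delta>)" "path \<delta>"
      "pathstart \<delta> = pathfinish \<alpha>" "path_image \<delta> \<subseteq> V"
    using mem by (auto simp: tilde_basic_def)
  have \<delta>b: "\<alpha> +++ \<delta> \<in> based_paths x0"
    using \<delta> p by (auto simp: based_paths_def)
  \<comment> \<open>A member of a basic set is only given by a path in \<open>V\<close>; equality of
    endpoints makes \<open>\<delta>\<close> a loop.\<close>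
  have \<delta>f: "pathfinish \<delta> = pathfinish \<alpha>"
    using endpoint_coset_class[OF H \<beta>(1)] endpoint_coset_class[OF H \<delta>b] \<delta>(1) \<beta>(2) by simp
  have g: "?cl (\<alpha> +++ \<delta>) \<in> loop_subgroup \<alpha> V"
    using \<delta> \<delta>f by (auto simp: loop_subgroup_def based_loops_def)
  have h: "?cl \<beta> \<otimes>\<^bsub>?G\<^esub> inv\<^bsub>?G\<^esub> ?cl (\<alpha> +++ \<delta>) \<in> H"
    using \<delta>(1) coset_class_eq_iff_conj[OF H \<alpha> \<beta>(1) \<delta>b] \<beta>(2) \<delta>f by simp
  have c: "?cl \<beta> \<in> carrier ?G" "?cl (\<alpha> +++ \<delta>) \<in> carrier ?G"
    using p \<delta> \<delta>f by (auto simp: based_loops_def)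
  \<comment> \<open>The factor from \<open>H\<close> is taken to be b times the inverse of g, so the
    product h g has to be folded back to b. The carrier stays folded because the group rules are
    stated with it.\<close>
  then have hg: "?cl \<beta> \<otimes>\<^bsub>?G\<^esub> inv\<^bsub>?G\<^esub> ?cl (\<alpha> +++ \<delta>) \<otimes>\<^bsub>?G\<^esub> ?cl (\<alpha> +++ \<delta>) = ?cl \<beta>"
    by (simp add: G.m_assoc del: carrier_fundamental_group)
  obtain k where k: "k \<in> loop_subgroup \<alpha> V"
      "?cl \<beta> \<otimes>\<^bsub>?G\<^esub> ?cl \<beta> \<otimes>\<^bsub>?G\<^esub> inv\<^bsub>?G\<^esub> (?cl \<beta> \<otimes>\<^bsub>?G\<^esub> k) \<in> H"
    using G.square_in_coset_of_permuting_subgroups[OF H subgroup_loop_subgroup[OF \<alpha> V(1)] V(2) h g]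
    unfolding hg by blast
  obtain \<epsilon> where \<epsilon>: "k = ?cl (\<alpha> +++ \<epsilon>)" "\<epsilon> \<in> based_loops (pathfinish \<alpha>)" "path_image \<epsilon> \<subseteq> V"
    using k(1) by (auto simp: loop_subgroup_def)
  have \<epsilon>': "?cl (\<beta> +++ \<epsilon>) = ?cl \<beta> \<otimes>\<^bsub>?G\<^esub> k"
    unfolding \<epsilon>(1) using p \<epsilon> by (intro path_class_conj_hom) (auto simp: based_loops_def)
  \<comment> \<open>The conjugate of \<open>?\<gamma>\<close> by \<open>\<alpha>\<close> is b
    itself, so appending \<open>?\<gamma>\<close> to \<open>\<beta>\<close> squares b.\<close>
  have "homotopic_paths UNIV ((\<alpha> +++ ?\<gamma>) +++ reversepath \<alpha>) (\<beta> +++ reversepath \<alpha>)"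
    using p by (intro homotopic_paths_join homotopic_join_reversepath_join) auto
  then have "?cl (\<alpha> +++ ?\<gamma>) = ?cl \<beta>"
    by (rule path_class_cong)
  then have \<gamma>': "?cl (\<beta> +++ ?\<gamma>) = ?cl \<beta> \<otimes>\<^bsub>?G\<^esub> ?cl \<beta>"
    using path_class_conj_hom[of \<alpha> \<beta> ?\<gamma> x0] p by auto
  have "coset_class x0 H (\<beta> +++ ?\<gamma>) = coset_class x0 H (\<beta> +++ \<epsilon>)"
    using k(2) p \<epsilon>(2) \<alpha> unfolding \<gamma>'[symmetric] \<epsilon>'[symmetric]
    by (subst coset_class_eq_iff_conj[OF H \<alpha>]) (auto simp: based_paths_def based_loops_def)
  then show ?thesis
    using \<epsilon> \<beta>(2) by (auto simp: tilde_basic_def based_loops_def)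
qed

theorem proposition9p11:
  fixes x0 :: "'a::topological_space" and H :: "(real \<Rightarrow> 'a) set set"
  assumes "path_connected (UNIV :: 'a set)"
    and "subgroup H (fundamental_group x0)"
    and "locally_quasinormal x0 H"
    and "discrete_monodromy x0 H"
  shows "\<forall>x. t1_space (subtopology (tilde_topology x0 H) (tilde_fiber x0 H x))"
proof (intro allI, unfold t1_space_def, intro ballI impI, rule ccontr)
  fix x a b
  let ?F = "tilde_fiber x0 H x" and ?c = "coset_class x0 H"
  let ?T = "subtopology (tilde_topology x0 H) ?F"
  note H = assms(2)
  assume "a \<in> topspace ?T" "b \<in> topspace ?T" and ne: "a \<noteq> b"
    and no: "\<not> (\<exists>U. openin ?T U \<and> a \<in> U \<and> b \<notin> U)"
  then have F: "a \<in> ?F" "b \<in> ?F"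
    by auto
  obtain \<alpha> \<beta> where \<alpha>: "\<alpha> \<in> based_paths x0" "a = ?c \<alpha>" and \<beta>: "\<beta> \<in> based_paths x0" "b = ?c \<beta>"
    using F unfolding tilde_fiber_def tilde_set_def coset_class_def by (auto elim!: quotientE)
  have fin: "pathfinish \<alpha> = x" "pathfinish \<beta> = x"
    using F endpoint_coset_class[OF H] \<alpha> \<beta> by (auto simp: tilde_fiber_def)
  \<comment> \<open>Otherwise a basic set, cut down to the fiber, would separate \<open>a\<close>
    from \<open>b\<close>.\<close>
  have near: "b \<in> tilde_basic x0 H \<alpha> V" if "open V" "x \<in> V" for V
  proof -
    have "openin (tilde_topology x0 H) (tilde_basic x0 H \<alpha> V)"
      unfolding tilde_topology_def using that \<alpha> fin by (intro topology_generated_by_Basis) auto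
    then have "openin ?T (tilde_basic x0 H \<alpha> V \<inter> ?F)"
      by (auto simp: openin_subtopology)
    then show ?thesis
      using no F coset_class_in_tilde_basic[OF H \<alpha>(1)] that fin \<alpha>(2) by blast
  qed
  define \<gamma> where "\<gamma> = reversepath \<alpha> +++ \<beta>"
  have \<gamma>: "path \<gamma>" "pathstart \<gamma> = x" "pathfinish \<gamma> = x"
    using \<alpha> \<beta> fin by (auto simp: \<gamma>_def based_paths_def)
  have "?c (\<alpha> +++ \<gamma>) = b"
    unfolding \<gamma>_def \<beta>(2) using \<alpha> \<beta>
    by (intro coset_class_homotopic[OF H] homotopic_join_reversepath_join)
      (auto simp: based_paths_def)
  then have ma: "monodromy x0 H \<gamma> a = b"
    using monodromy_coset_class[OF H \<alpha>(1)] \<gamma> fin \<alpha>(2) by simp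
  have mb: "monodromy x0 H \<gamma> b = ?c (\<beta> +++ \<gamma>)"
    using monodromy_coset_class[OF H \<beta>(1)] \<gamma> fin \<beta>(2) by simp
  have "\<beta> +++ \<gamma> \<in> based_paths x0"
    using \<beta> \<gamma> fin by (auto simp: based_paths_def)
  then have mbF: "?c (\<beta> +++ \<gamma>) \<in> ?F"
    using endpoint_coset_class[OF H, of "\<beta> +++ \<gamma>"] \<gamma>
    by (auto simp: tilde_fiber_def tilde_set_def coset_class_def intro: quotientI)
  have graph: "(a, b) \<in> monodromy_graph x0 H \<gamma>" "(b, ?c (\<beta> +++ \<gamma>)) \<in> monodromy_graph x0 H \<gamma>"
    using F ma mb \<gamma> by (auto simp: monodromy_graph_def)
  \<comment> \<open>The identity alternative is excluded, since \<open>a\<close> is moved to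
    \<open>b\<close>.\<close>
  have "subtopology (prod_topology ?T ?T) (monodromy_graph x0 H \<gamma>)
      = discrete_topology (monodromy_graph x0 H \<gamma>)"
    using assms(4) \<gamma> ma ne F unfolding discrete_monodromy_def by metis
  then have "openin (subtopology (prod_topology ?T ?T) (monodromy_graph x0 H \<gamma>)) {(a, b)}"
    using graph by simp
  then obtain W where W: "openin (prod_topology ?T ?T) W"
      "{(a, b)} = W \<inter> monodromy_graph x0 H \<gamma>"
    by (auto simp: openin_subtopology)
  then have "(a, b) \<in> W"
    by blast
  then obtain A B where AB: "openin ?T A" "openin ?T B" "a \<in> A" "b \<in> B" "A \<times> B \<subseteq> W"
    using W(1) unfolding openin_prod_topology_alt by meson
  then obtain A' B' where A': "openin (tilde_topology x0 H) A'" "A = A' \<inter> ?F"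
    and B': "openin (tilde_topology x0 H) B'" "B = B' \<inter> ?F"
    by (auto simp: openin_subtopology)
  obtain U1 where U1: "open U1" "x \<in> U1" "tilde_basic x0 H \<alpha> U1 \<subseteq> A'"
    using openin_tilde_topology_nbhd[OF H A'(1) \<alpha>(1)] AB \<alpha> A' fin by auto
  obtain U2 where U2: "open U2" "x \<in> U2" "tilde_basic x0 H \<beta> U2 \<subseteq> B'"
    using openin_tilde_topology_nbhd[OF H B'(1) \<beta>(1)] AB \<beta> B' fin by auto
  \<comment> \<open>Only the second coordinate needs the permuting neighborhood, hence
    \<open>V\<close> inside \<open>U2\<close>; for the first, \<open>b\<close> lies in every
    neighborhood of \<open>a\<close>.\<close>
  have "\<exists>V. open V \<and> x \<in> V \<and> V \<subseteq> U2 \<and>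
      H <#>\<^bsub>fundamental_group x0\<^esub> loop_subgroup \<alpha> V =
      loop_subgroup \<alpha> V <#>\<^bsub>fundamental_group x0\<^esub> H"
    using assms(3)[unfolded locally_quasinormal_def, rule_format, OF \<alpha>(1), of x U2] U2 fin
    by blast
  then obtain V where V: "open V" "x \<in> V" "V \<subseteq> U2"
      "H <#>\<^bsub>fundamental_group x0\<^esub> loop_subgroup \<alpha> V =
       loop_subgroup \<alpha> V <#>\<^bsub>fundamental_group x0\<^esub> H"
    by blast
  have "?c (\<beta> +++ \<gamma>) \<in> tilde_basic x0 H \<beta> V"
    unfolding \<gamma>_def using monodromy_in_tilde_basic[OF H \<alpha>(1) \<beta>(1)] V near[OF V(1,2)] fin \<beta>(2)
    by simp
  moreover have "tilde_basic x0 H \<beta> V \<subseteq> tilde_basic x0 H \<beta> U2"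
    using V(3) unfolding tilde_basic_def by blast
  ultimately have "?c (\<beta> +++ \<gamma>) \<in> B"
    using U2(3) mbF B'(2) by auto
  moreover have "b \<in> A"
    using near[OF U1(1,2)] U1(3) A'(2) F by auto
  \<comment> \<open>This graph point lies in \<open>W\<close>, which isolates \<open>(a, b)\<close>;
    comparing first coordinates gives \<open>a = b\<close>.\<close>
  ultimately have "(b, ?c (\<beta> +++ \<gamma>)) \<in> {(a, b)}"
    using AB(5) W(2) graph(2) by blast
  then show False
    using ne by simp
qed

end
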